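(* Let $B, B_0,\dots,B_k$ be linear endomorphisms of $V$, each self-adjoint or skew-adjoint, and let $R\in\mathcal{A}(V)$ satisfy $$R=\epsilon R_{B}+\sum_{i=0}^k\epsilon_iR_{B_i},\qquad \epsilon,\epsilon_i\in\{\pm1\},$$ where $\ker(B)\ne 0$. Then for any linear operator $A:V\to\ker(B)$ (regarded as an endomorphism of $V$ with image in $\ker B$), $$\bar R:=A*R=\sum_{i=0}^k\epsilon_iR_{A^*B_iA}.$$ Moreover, for each $i$, $R_{A^*B_iA}\in\mathcal{A}(V)$ and $R_{A^*B_iA}$ is the same build as $R_{B_i}$.
   Context: $V$ is a finite-dimensional real vector space, $\phi$ a positive definite inner product on $V$, and $A^*$ the adjoint of $A$ with respect to $\phi$. $\mathcal{A}(V)$ is the real vector space of algebraic curvature tensors: multilinear maps $R:V^4\to\mathbb{R}$ with $R(x,y,z,w)=-R(y,x,z,w)=R(z,w,x,y)$ and $R(x,y,z,w)+R(z,x,y,w)+R(y,z,x,w)=0$. For an endomorphism $A$ of $V$, $$R^S_{A}(x,y,z,w)= \phi (Ax,w) \phi (Ay,z) - \phi (Ax,z) \phi (Ay,w),$$ $$R^{\Lambda}_{A} (x,y,z,w) =\phi (Ax,w) \phi (Ay,z) - \phi (Ax,z) \phi (Ay,w) -2 \phi (Ax,y) \phi (Az,w).$$ The symbol $R_{B}$ without superscript means $R^S_B$ (symmetric build) if $B=B^*$ and $R^{\Lambda}_B$ (anti-symmetric build) if $B=-B^*$; the builds of the different terms may differ. "$R_{A^*B_iA}$ is the same build as $R_{B_i}$"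 means that $A^*B_iA$ is self-adjoint (and the tensor is $R^S$) if $B_i$ is self-adjoint, and skew-adjoint (and the tensor is $R^\Lambda$) if $B_i$ is skew-adjoint. $A*R$ denotes precomposition: $(A*R)(x,y,z,w)=R(Ax,Ay,Az,Aw)$. *)

theory Defs
  imports "HOL-Analysis.Analysis"
begin

(* V is a type of class euclidean_space and the positive definite form phi is its inner
   product; endomorphisms are functions satisfying "linear". *)

definition self_adjoint :: "('a::euclidean_space \<Rightarrow> 'a) \<Rightarrow> bool" where
  "self_adjoint B \<longleftrightarrow> B = adjoint B"

definition skew_adjoint :: "('a::euclidean_space \<Rightarrow> 'a) \<Rightarrow> bool" where
  "skew_adjoint B \<longleftrightarrow> B = (\<lambda>x. - adjoint B x)"

definition ker :: "('a::euclidean_space \<Rightarrow> 'a) \<Rightarrow> 'a set" where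
  "ker B = {x. B x = 0}"

type_synonym 'a tensor4 = "'a \<Rightarrow> 'a \<Rightarrow> 'a \<Rightarrow> 'a \<Rightarrow> real"

definition multilinear4 :: "'a::euclidean_space tensor4 \<Rightarrow> bool" where
  "multilinear4 R \<longleftrightarrow>
     (\<forall>y z w. linear (\<lambda>x. R x y z w)) \<and>
     (\<forall>x z w. linear (\<lambda>y. R x y z w)) \<and>
     (\<forall>x y w. linear (\<lambda>z. R x y z w)) \<and>
     (\<forall>x y z. linear (\<lambda>w. R x y z w))"

definition curvature_tensors :: "'a::euclidean_space tensor4 set" where
  "curvature_tensors = {R. multilinear4 R \<and>
     (\<forall>x y z w. R x y z w = - R y x z w) \<and>
     (\<forall>x y z w. R x y z w = R z w x y) \<and>
     (\<forall>x y z w. R x y z w + R z x y w + R y z x w = 0)}"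

definition R_sym :: "('a::euclidean_space \<Rightarrow> 'a) \<Rightarrow> 'a tensor4" where
  "R_sym A x y z w = (A x \<bullet> w) * (A y \<bullet> z) - (A x \<bullet> z) * (A y \<bullet> w)"

definition R_skew :: "('a::euclidean_space \<Rightarrow> 'a) \<Rightarrow> 'a tensor4" where
  "R_skew A x y z w =
     (A x \<bullet> w) * (A y \<bullet> z) - (A x \<bullet> z) * (A y \<bullet> w) - 2 * (A x \<bullet> y) * (A z \<bullet> w)"

(* The tensor R_B without superscript.  A linear B that is both self-adjoint and skew-adjoint
   is zero, and R_sym and R_skew agree there; for B that is neither, the value is unspecified. *)
definition R_build :: "('a::euclidean_space \<Rightarrow> 'a) \<Rightarrow> 'a tensor4" where
  "R_build B =
     (if self_adjoint B then R_sym B else if skew_adjoint B then R_skew B else undefined)"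

definition same_build :: "('a::euclidean_space \<Rightarrow> 'a) \<Rightarrow> ('a \<Rightarrow> 'a) \<Rightarrow> bool" where
  "same_build C B \<longleftrightarrow>
     (self_adjoint B \<longrightarrow> self_adjoint C \<and> R_build C = R_sym C) \<and>
     (skew_adjoint B \<longrightarrow> skew_adjoint C \<and> R_build C = R_skew C)"

definition pullback :: "('a::euclidean_space \<Rightarrow> 'a) \<Rightarrow> 'a tensor4 \<Rightarrow> 'a tensor4" where
  "pullback A R x y z w = R (A x) (A y) (A z) (A w)"

end

theory Submission imports Defs begin

text \<open>
  Both builds are polynomials in the bilinear form \<open>B x \<bullet> y\<close>, and the form of \<open>A\<^sup>* B A\<close> is
  the pullback of the form of \<open>B\<close> along \<open>A\<close>, because \<open>A\<^sup>* (B (A x)) \<bullet> y = B (A x) \<bullet> A y\<close>.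
  Hence precomposition with \<open>A\<close> turns \<open>R\<close> of \<open>B\<close> into \<open>R\<close> of \<open>A\<^sup>* B A\<close>, build by build
  (\<open>pullback_R_sym\<close>, \<open>pullback_R_skew\<close>), and congruence by \<open>A\<close> keeps a form symmetric or
  antisymmetric, so the build does not change (\<open>pullback_R_build\<close>).  Pulling back the given
  decomposition of \<open>R\<close> therefore gives the claimed sum plus the pullback of the \<open>B\<close> term,
  and that term vanishes since \<open>B \<circ> A = 0\<close>.  Finally, the build of any self-adjoint or skew-adjoint
  map is an algebraic curvature tensor (\<open>R_build_curvature\<close>), by the symmetry of its form.
\<close>

lemma self_adjoint_iff:
  assumes "linear B"
  shows "self_adjoint B \<longleftrightarrow> (\<forall>x y. B x \<bullet> y = x \<bullet> B y)"
proof
  show "\<forall>x y. B x \<bullet> y = x \<bullet> B y" if "self_adjoint B"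
    using that adjoint_works[OF assms] unfolding self_adjoint_def by metis
  show "self_adjoint B" if "\<forall>x y. B x \<bullet> y = x \<bullet> B y"
    using adjoint_unique[of B B] that unfolding self_adjoint_def by (metis inner_commute)
qed

lemma skew_adjoint_iff:
  assumes "linear B"
  shows "skew_adjoint B \<longleftrightarrow> (\<forall>x y. B x \<bullet> y = - (x \<bullet> B y))"
proof
  assume B: "skew_adjoint B"
  have "B y = - adjoint B y" for y
    using B unfolding skew_adjoint_def by (rule fun_cong)
  then show "\<forall>x y. B x \<bullet> y = - (x \<bullet> B y)"
    using adjoint_works[OF assms] by (metis inner_minus_right minus_minus)
next
  assume "\<forall>x y. B x \<bullet> y = - (x \<bullet> B y)"
  then have "adjoint B = (\<lambda>x. - B x)"
    by (intro adjoint_unique) simp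
  then show "skew_adjoint B"
    by (simp add: skew_adjoint_def)
qed

lemma R_build_self: "self_adjoint B \<Longrightarrow> R_build B = R_sym B"
  by (simp add: R_build_def)

text \<open>
  A map which is both self-adjoint and skew-adjoint is zero, and then the two builds agree; this makes
  the order of the cases in \<open>R_build\<close> harmless.
\<close>

lemma R_build_skew:
  assumes "skew_adjoint B"
  shows "R_build B = R_skew B"
proof (cases "self_adjoint B")
  case True
  have "B x = 0" for x
  proof -
    have "B x = - adjoint B x"
      using assms unfolding skew_adjoint_def by (rule fun_cong)
    also have "adjoint B x = B x"
      using True unfolding self_adjoint_def by simp
    finally have "2 *\<^sub>R B x = 0"
      by (simp only: scaleR_2 eq_neg_iff_add_eq_0)
    then show ?thesis
      by simp
  qed
  then show ?thesis
    by (simp add: R_build_def True fun_eq_iff R_sym_def R_skew_def)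
qed (simp add: R_build_def assms)

lemma multilinear4_R_sym:
  assumes "linear B"
  shows "multilinear4 (R_sym B)"
  unfolding multilinear4_def R_sym_def
  by (auto intro!: linearI simp: linear_add[OF assms] linear_cmul[OF assms]
      algebra_simps)

lemma multilinear4_R_skew:
  assumes "linear B"
  shows "multilinear4 (R_skew B)"
  unfolding multilinear4_def R_skew_def
  by (auto intro!: linearI simp: linear_add[OF assms] linear_cmul[OF assms]
      algebra_simps)

lemma R_sym_curvature:
  assumes "linear B" and "self_adjoint B"
  shows "R_sym B \<in> curvature_tensors"
proof -
  have sym: "B x \<bullet> y = B y \<bullet> x" for x y
    using assms self_adjoint_iff by (metis inner_commute)
  have "R_sym B x y z w = - R_sym B y x z w" for x y z w
    by (simp add: R_sym_def)
  moreover have "R_sym B x y z w = R_sym B z w x y" for x y z w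
    by (simp add: R_sym_def sym[of z x] sym[of z y] sym[of w x] sym[of w y] mult.commute)
  moreover have "R_sym B x y z w + R_sym B z x y w + R_sym B y z x w = 0" for x y z w
    by (simp add: R_sym_def sym[of z x] sym[of z y] sym[of y x] mult.commute)
  ultimately show ?thesis
    using multilinear4_R_sym[OF assms(1)] unfolding curvature_tensors_def by blast
qed

text \<open>
  For an antisymmetric form \<open>b\<close>, each of the products \<open>b(x,w) b(y,z)\<close>, \<open>b(x,z) b(y,w)\<close> and
  \<open>b(x,y) b(z,w)\<close> occurs in the cyclic sum twice with one sign from the first two terms of the
  build and once with coefficient 2 and the opposite sign from the last term; the factor \<open>2\<close>
  is what makes the Bianchi identity hold.
\<close>

lemma R_skew_curvature:
  assumes "linear B" and "skew_adjoint B"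
  shows "R_skew B \<in> curvature_tensors"
proof -
  have skew: "B x \<bullet> y = - (B y \<bullet> x)" for x y
    using assms skew_adjoint_iff by (metis inner_commute)
  have "R_skew B x y z w = - R_skew B y x z w" for x y z w
    by (simp add: R_skew_def skew[of y x])
  moreover have "R_skew B x y z w = R_skew B z w x y" for x y z w
    by (simp add: R_skew_def skew[of z x] skew[of z y] skew[of w x] skew[of w y] mult.commute)
  moreover have "R_skew B x y z w + R_skew B z x y w + R_skew B y z x w = 0" for x y z w
    by (simp add: R_skew_def skew[of z x] skew[of z y] skew[of y x] algebra_simps)
  ultimately show ?thesis
    using multilinear4_R_skew[OF assms(1)] unfolding curvature_tensors_def by blast
qed

lemma R_build_curvature:
  assumes "linear B" and "self_adjoint B \<or> skew_adjoint B"
  shows "R_build B \<in> curvature_tensors"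
  using assms R_sym_curvature R_skew_curvature by (auto simp: R_build_self R_build_skew)

lemma inner_congruence:
  fixes A B :: "'a::euclidean_space \<Rightarrow> 'a"
  assumes "linear A"
  shows "(adjoint A \<circ> B \<circ> A) x \<bullet> y = B (A x) \<bullet> A y"
  using adjoint_works[OF assms] by (simp add: inner_commute)

lemma linear_congruence:
  fixes A B :: "'a::euclidean_space \<Rightarrow> 'a"
  assumes "linear A" and "linear B"
  shows "linear (adjoint A \<circ> B \<circ> A)"
  using assms by (intro linear_compose adjoint_linear)

lemma self_adjoint_congruence:
  fixes A B :: "'a::euclidean_space \<Rightarrow> 'a"
  assumes "linear A" and "linear B" and "self_adjoint B"
  shows "self_adjoint (adjoint A \<circ> B \<circ> A)"
  unfolding self_adjoint_iff[OF linear_congruence[OF assms(1,2)]]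
  using assms self_adjoint_iff[of B] inner_congruence[OF assms(1), of B]
  by (metis inner_commute)

lemma skew_adjoint_congruence:
  fixes A B :: "'a::euclidean_space \<Rightarrow> 'a"
  assumes "linear A" and "linear B" and "skew_adjoint B"
  shows "skew_adjoint (adjoint A \<circ> B \<circ> A)"
  unfolding skew_adjoint_iff[OF linear_congruence[OF assms(1,2)]]
  using assms skew_adjoint_iff[of B] inner_congruence[OF assms(1), of B]
  by (metis inner_commute)

lemma same_build_congruence:
  fixes A B :: "'a::euclidean_space \<Rightarrow> 'a"
  assumes "linear A" and "linear B"
  shows "same_build (adjoint A \<circ> B \<circ> A) B"
  using self_adjoint_congruence[OF assms] skew_adjoint_congruence[OF assms]
  by (simp add: same_build_def R_build_self R_build_skew)

lemma pullback_R_sym: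
  fixes A B :: "'a::euclidean_space \<Rightarrow> 'a"
  assumes "linear A"
  shows "pullback A (R_sym B) = R_sym (adjoint A \<circ> B \<circ> A)"
  unfolding fun_eq_iff pullback_def R_sym_def inner_congruence[OF assms] by simp

lemma pullback_R_skew:
  fixes A B :: "'a::euclidean_space \<Rightarrow> 'a"
  assumes "linear A"
  shows "pullback A (R_skew B) = R_skew (adjoint A \<circ> B \<circ> A)"
  unfolding fun_eq_iff pullback_def R_skew_def inner_congruence[OF assms] by simp

lemma pullback_R_build:
  fixes A B :: "'a::euclidean_space \<Rightarrow> 'a"
  assumes "linear A" and "linear B" and "self_adjoint B \<or> skew_adjoint B"
  shows "pullback A (R_build B) = R_build (adjoint A \<circ> B \<circ> A)"
  using assms(3)
proof
  assume "self_adjoint B"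
  with self_adjoint_congruence[OF assms(1,2)] show ?thesis
    by (simp only: R_build_self pullback_R_sym[OF assms(1)])
next
  assume "skew_adjoint B"
  with skew_adjoint_congruence[OF assms(1,2)] show ?thesis
    by (simp only: R_build_skew pullback_R_skew[OF assms(1)])
qed

lemma pullback_R_build_ker:
  assumes "self_adjoint B \<or> skew_adjoint B" and "range A \<subseteq> ker B"
  shows "pullback A (R_build B) = (\<lambda>x y z w. 0)"
proof -
  have "B (A x) = 0" for x
    using assms(2) by (auto simp: ker_def)
  with assms(1) show ?thesis
    by (auto simp: fun_eq_iff pullback_def R_build_self R_build_skew R_sym_def R_skew_def)
qed

theorem theorem6p1:
  fixes B A :: "'a::euclidean_space \<Rightarrow> 'a"
    and Bs :: "nat \<Rightarrow> 'a \<Rightarrow> 'a"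
    and k :: nat
    and \<epsilon> :: real and \<epsilon>s :: "nat \<Rightarrow> real"
    and R :: "'a tensor4"
  assumes "linear B" and "self_adjoint B \<or> skew_adjoint B"
    and "\<And>i. i \<le> k \<Longrightarrow> linear (Bs i)"
    and "\<And>i. i \<le> k \<Longrightarrow> self_adjoint (Bs i) \<or> skew_adjoint (Bs i)"
    and "\<epsilon> \<in> {1, -1}" and "\<And>i. i \<le> k \<Longrightarrow> \<epsilon>s i \<in> {1, -1}"
    and "R \<in> curvature_tensors"
    and "R = (\<lambda>x y z w. \<epsilon> * R_build B x y z w + (\<Sum>i=0..k. \<epsilon>s i * R_build (Bs i) x y z w))"
    and "ker B \<noteq> {0}"
    and "linear A" and "range A \<subseteq> ker B"
  shows "pullback A R =
           (\<lambda>x y z w. \<Sum>i=0..k. \<epsilon>s i * R_build (adjoint A \<circ> Bs i \<circ> A) x y z w)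
         \<and> (\<forall>i\<le>k. R_build (adjoint A \<circ> Bs i \<circ> A) \<in> curvature_tensors
               \<and> same_build (adjoint A \<circ> Bs i \<circ> A) (Bs i))"
proof (intro conjI allI impI)
  have B: "R_build B (A x) (A y) (A z) (A w) = 0" for x y z w
    using pullback_R_build_ker[OF assms(2) assms(11)] by (metis pullback_def)
  have Bs: "R_build (Bs i) (A x) (A y) (A z) (A w)
      = R_build (adjoint A \<circ> Bs i \<circ> A) x y z w" if "i \<le> k" for i x y z w
    using pullback_R_build[OF assms(10) assms(3)[OF that] assms(4)[OF that]]
    by (metis pullback_def)
  show "pullback A R =
      (\<lambda>x y z w. \<Sum>i=0..k. \<epsilon>s i * R_build (adjoint A \<circ> Bs i \<circ> A) x y z w)"
  proof (intro ext)
    fix x y z w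
    have "pullback A R x y z w = (\<Sum>i=0..k. \<epsilon>s i * R_build (Bs i) (A x) (A y) (A z) (A w))"
      unfolding pullback_def assms(8) by (simp add: B)
    also have "\<dots> = (\<Sum>i=0..k. \<epsilon>s i * R_build (adjoint A \<circ> Bs i \<circ> A) x y z w)"
      by (intro sum.cong refl) (simp only: Bs atLeastAtMost_iff)
    finally show "pullback A R x y z w
        = (\<Sum>i=0..k. \<epsilon>s i * R_build (adjoint A \<circ> Bs i \<circ> A) x y z w)" .
  qed
next
  fix i assume "i \<le> k"
  then have Bi: "linear (Bs i)" "self_adjoint (Bs i) \<or> skew_adjoint (Bs i)"
    using assms(3,4) by blast+
  show "R_build (adjoint A \<circ> Bs i \<circ> A) \<in> curvature_tensors"
    using Bi self_adjoint_congruence[OF assms(10)] skew_adjoint_congruence[OF assms(10)]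
    by (intro R_build_curvature linear_congruence assms(10)) blast+
  show "same_build (adjoint A \<circ> Bs i \<circ> A) (Bs i)"
    by (rule same_build_congruence[OF assms(10) Bi(1)])
qed

end
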